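(* Let $G$ be a group of order $8$, let $\mathbb{F}$ be an algebraically closed field with $\operatorname{char}(\mathbb{F})\neq 2$, and let $n$ be a positive integer. If $\Xi_G$ is the space of invariant bilinear forms under an $n$ degree representation $\rho=\bigoplus_{i=1}^{r}k_i\rho_i$ of $G$ over $\mathbb{F}$, then $$\dim(\Xi_G)=\sum_{(i,j)\in A_G}k_ik_j.$$
   Context: An $n$ degree representation is a homomorphism $\rho:G\to GL(\mathbb{V})$ with $\mathbb{V}$ an $n$-dimensional $\mathbb{F}$-vector space. $\rho_1,\dots,\rho_r$ is a complete list of pairwise non-isomorphic irreducible representations of $G$ over $\mathbb{F}$, and $k_i\rho_i$ is the direct sum of $k_i\ge0$ copies of $\rho_i$. $\Xi_G$ is the space of bilinear forms $\mathbb{B}$ on $\mathbb{V}$ with $\mathbb{B}(\rho(g)x,\rho(g)y)=\mathbb{B}(x,y)$ for all $g\in G$, $x,y\in\mathbb{V}$. $A_G$ is the set of ordered pairs $(i,j)$, $1\le i,j\le r$, such that $\rho_i$ and $\rho_j$ are dual to each other, i.e. $\rho_j$ is isomorphic to the dual (contragredient) of $\rho_i$. *)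

theory Defs
  imports
    "HOL-Algebra.Coset"
    "HOL-Algebra.Bij"
    "HOL-Computational_Algebra.Computational_Algebra"
    "HOL-Library.Function_Algebras"
begin

text \<open>
  Vector spaces are subspaces \<open>V\<close> of an ambient space given by the library locale
  \<^locale>\<open>vector_space\<close>. This allows spaces of different dimensions over one type, as needed
  for a list of irreducible representations.
\<close>

definition linear_on ::
  "('f::field \<Rightarrow> 'v::ab_group_add \<Rightarrow> 'v) \<Rightarrow> ('f \<Rightarrow> 'w::ab_group_add \<Rightarrow> 'w) \<Rightarrow> 'v set \<Rightarrow> ('v \<Rightarrow> 'w) \<Rightarrow> bool"
  where "linear_on s t V f \<longleftrightarrow>
    (\<forall>x\<in>V. \<forall>y\<in>V. f (x + y) = f x + f y) \<and> (\<forall>a. \<forall>x\<in>V. f (s a x) = t a (f x))"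

definition GL :: "('f::field \<Rightarrow> 'v::ab_group_add \<Rightarrow> 'v) \<Rightarrow> 'v set \<Rightarrow> ('v \<Rightarrow> 'v) monoid"
  where "GL s V = (BijGroup V)\<lparr>carrier := {f \<in> Bij V. linear_on s s V f}\<rparr>"

text \<open>Pointwise scalar multiplication; addition of functions is pointwise by
  \<^theory>\<open>HOL-Library.Function_Algebras\<close>.\<close>

definition fun_scale :: "('f::field \<Rightarrow> 'v::ab_group_add \<Rightarrow> 'v) \<Rightarrow> 'f \<Rightarrow> ('i \<Rightarrow> 'v) \<Rightarrow> 'i \<Rightarrow> 'v"
  where "fun_scale s a f = (\<lambda>i. s a (f i))"

lemma vector_space_fun_scale:
  assumes "vector_space s"
  shows "vector_space (fun_scale s)"
proof -
  interpret vector_space s by fact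
  show ?thesis
    by unfold_locales (auto simp: fun_scale_def fun_eq_iff scale_right_distrib scale_left_distrib)
qed

lemma vector_space_field: "vector_space ((*) :: 'f::field \<Rightarrow> 'f \<Rightarrow> 'f)"
  by unfold_locales (auto simp: algebra_simps)

locale group_representation = group G + vector_space s
  for G :: "('g, 'm) monoid_scheme" (structure)
    and s :: "'f::field \<Rightarrow> 'v::ab_group_add \<Rightarrow> 'v" +
  fixes V :: "'v set" and \<rho> :: "'g \<Rightarrow> 'v \<Rightarrow> 'v"
  assumes subspace_V: "subspace V"
    and finite_dim: "\<exists>B. finite B \<and> span B = V"
    and hom: "\<rho> \<in> hom G (GL s V)"

locale irreducible_representation = group_representation +
  assumes nonzero: "V \<noteq> {0}"
    and irreducible:
      "\<And>U. subspace U \<Longrightarrow> U \<subseteq> V \<Longrightarrow> (\<forall>g\<in>carrier G. \<rho> g ` U \<subseteq> U) \<Longrightarrow> U = {0} \<or> U = V"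

definition isomorphic_rep ::
  "('g, 'm) monoid_scheme \<Rightarrow>
   ('f::field \<Rightarrow> 'v::ab_group_add \<Rightarrow> 'v) \<Rightarrow> 'v set \<Rightarrow> ('g \<Rightarrow> 'v \<Rightarrow> 'v) \<Rightarrow>
   ('f \<Rightarrow> 'w::ab_group_add \<Rightarrow> 'w) \<Rightarrow> 'w set \<Rightarrow> ('g \<Rightarrow> 'w \<Rightarrow> 'w) \<Rightarrow> bool"
  where "isomorphic_rep G s V \<rho> t W \<sigma> \<longleftrightarrow>
    (\<exists>T. bij_betw T V W \<and> linear_on s t V T \<and>
      (\<forall>g\<in>carrier G. \<forall>x\<in>V. T (\<rho> g x) = \<sigma> g (T x)))"

text \<open>
  The representations \<open>(W i, \<sigma> i)\<close>, \<open>1 \<le> i \<le> r\<close>, are a complete list of pairwise non-isomorphic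
  irreducible representations. Completeness has to be stated for representations on one fixed
  ambient type; the one chosen is the space of all sequences over the field, in which every
  finite-dimensional vector space embeds (a smaller type could omit irreducible representations).
\<close>

definition complete_irreps ::
  "('g, 'm) monoid_scheme \<Rightarrow> ('f::field \<Rightarrow> 'w::ab_group_add \<Rightarrow> 'w) \<Rightarrow> nat \<Rightarrow>
   (nat \<Rightarrow> 'w set) \<Rightarrow> (nat \<Rightarrow> 'g \<Rightarrow> 'w \<Rightarrow> 'w) \<Rightarrow> bool"
  where "complete_irreps G t r W \<sigma> \<longleftrightarrow>
    (\<forall>i\<in>{1..r}. irreducible_representation G t (W i) (\<sigma> i)) \<and>
    (\<forall>i\<in>{1..r}. \<forall>j\<in>{1..r}. i \<noteq> j \<longrightarrow> \<not> isomorphic_rep G t (W i) (\<sigma> i) t (W j) (\<sigma> j)) \<and>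
    (\<forall>(U :: (nat \<Rightarrow> 'f) set) \<tau>.
      irreducible_representation G (fun_scale (*)) U \<tau> \<longrightarrow>
      (\<exists>i\<in>{1..r}. isomorphic_rep G (fun_scale (*)) U \<tau> t (W i) (\<sigma> i)))"

text \<open>
  The external direct sum of \<open>k i\<close> copies of \<open>(W i, \<sigma> i)\<close>, \<open>1 \<le> i \<le> r\<close>: families of vectors
  indexed by the pairs \<open>(i, c)\<close> with \<open>c < k i\<close>, padded by zero, with scalar multiplication
  \<open>fun_scale t\<close>.
\<close>

definition copies :: "nat \<Rightarrow> (nat \<Rightarrow> nat) \<Rightarrow> (nat \<times> nat) set"
  where "copies r k = (SIGMA i:{1..r}. {..<k i})"

definition sum_space ::
  "nat \<Rightarrow> (nat \<Rightarrow> nat) \<Rightarrow> (nat \<Rightarrow> 'w::zero set) \<Rightarrow> (nat \<times> nat \<Rightarrow> 'w) set"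
  where "sum_space r k W =
    {f. (\<forall>p\<in>copies r k. f p \<in> W (fst p)) \<and> (\<forall>p. p \<notin> copies r k \<longrightarrow> f p = 0)}"

definition sum_action ::
  "nat \<Rightarrow> (nat \<Rightarrow> nat) \<Rightarrow> (nat \<Rightarrow> 'w::zero set) \<Rightarrow> (nat \<Rightarrow> 'g \<Rightarrow> 'w \<Rightarrow> 'w) \<Rightarrow>
   'g \<Rightarrow> (nat \<times> nat \<Rightarrow> 'w) \<Rightarrow> nat \<times> nat \<Rightarrow> 'w"
  where "sum_action r k W \<sigma> g =
    (\<lambda>f \<in> sum_space r k W. \<lambda>p. if p \<in> copies r k then \<sigma> (fst p) g (f p) else 0)"

text \<open>Linear functionals and bilinear forms on \<open>V\<close> are represented by functions on the ambient
  type that vanish outside \<open>V\<close>, so that they are determined by their values on \<open>V\<close>.\<close>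

definition dual_space :: "('f::field \<Rightarrow> 'v::ab_group_add \<Rightarrow> 'v) \<Rightarrow> 'v set \<Rightarrow> ('v \<Rightarrow> 'f) set"
  where "dual_space s V = {\<phi>. linear_on s (*) V \<phi> \<and> (\<forall>x. x \<notin> V \<longrightarrow> \<phi> x = 0)}"

definition dual_action ::
  "('g, 'm) monoid_scheme \<Rightarrow> ('f::field \<Rightarrow> 'v::ab_group_add \<Rightarrow> 'v) \<Rightarrow> 'v set \<Rightarrow>
   ('g \<Rightarrow> 'v \<Rightarrow> 'v) \<Rightarrow> 'g \<Rightarrow> ('v \<Rightarrow> 'f) \<Rightarrow> 'v \<Rightarrow> 'f"
  where "dual_action G s V \<rho> g =
    (\<lambda>\<phi> \<in> dual_space s V. \<lambda>x. if x \<in> V then \<phi> (\<rho> (inv\<^bsub>G\<^esub> g) x) else 0)"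

definition dual_pairs ::
  "('g, 'm) monoid_scheme \<Rightarrow> ('f::field \<Rightarrow> 'w::ab_group_add \<Rightarrow> 'w) \<Rightarrow> nat \<Rightarrow>
   (nat \<Rightarrow> 'w set) \<Rightarrow> (nat \<Rightarrow> 'g \<Rightarrow> 'w \<Rightarrow> 'w) \<Rightarrow> (nat \<times> nat) set"
  where "dual_pairs G t r W \<sigma> =
    {(i, j). i \<in> {1..r} \<and> j \<in> {1..r} \<and>
      isomorphic_rep G t (W j) (\<sigma> j)
        (fun_scale (*)) (dual_space t (W i)) (dual_action G t (W i) (\<sigma> i))}"

definition bilinear_forms :: "('f::field \<Rightarrow> 'v::ab_group_add \<Rightarrow> 'v) \<Rightarrow> 'v set \<Rightarrow> ('v \<Rightarrow> 'v \<Rightarrow> 'f) set"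
  where "bilinear_forms s V =
    {\<beta>. (\<forall>x\<in>V. linear_on s (*) V (\<lambda>y. \<beta> x y)) \<and>
        (\<forall>y\<in>V. linear_on s (*) V (\<lambda>x. \<beta> x y)) \<and>
        (\<forall>x y. x \<notin> V \<or> y \<notin> V \<longrightarrow> \<beta> x y = 0)}"

definition invariant_forms ::
  "('g, 'm) monoid_scheme \<Rightarrow> ('f::field \<Rightarrow> 'v::ab_group_add \<Rightarrow> 'v) \<Rightarrow> 'v set \<Rightarrow>
   ('g \<Rightarrow> 'v \<Rightarrow> 'v) \<Rightarrow> ('v \<Rightarrow> 'v \<Rightarrow> 'f) set"
  where "invariant_forms G s V \<rho> =
    {\<beta> \<in> bilinear_forms s V.
      \<forall>g\<in>carrier G. \<forall>x\<in>V. \<forall>y\<in>V. \<beta> (\<rho> g x) (\<rho> g y) = \<beta> x y}"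

abbreviation form_scale :: "'f::field \<Rightarrow> ('v \<Rightarrow> 'v \<Rightarrow> 'f) \<Rightarrow> 'v \<Rightarrow> 'v \<Rightarrow> 'f"
  where "form_scale \<equiv> fun_scale (fun_scale (*))"

lemma vector_space_form_scale: "vector_space form_scale"
  by (intro vector_space_fun_scale vector_space_field)

lemma subspace_invariant_forms: "module.subspace form_scale (invariant_forms G s V \<rho>)"
proof -
  interpret vector_space form_scale by (rule vector_space_form_scale)
  show ?thesis
    by (rule subspaceI)
      (auto simp: invariant_forms_def bilinear_forms_def linear_on_def fun_scale_def algebra_simps)
qed

end

theory Submission
  imports Defs
begin

text \<open>
  An invariant form on the sum of the \<open>W p\<close> is a matrix of invariant pairings
  \<open>W p \<times> W q \<rightarrow> F\<close>. Since the kernels of an invariant pairing are subrepresentations, a nonzero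
  pairing of irreducible representations is nondegenerate on both sides, so it identifies \<open>W q\<close>
  with the dual of \<open>W p\<close>. If \<open>a\<close> and \<open>b\<close> are two pairings and \<open>b\<close> is such an identification, then
  \<open>a x y = b x (A y)\<close> for an endomorphism \<open>A\<close>; for an eigenvalue \<open>c\<close> of \<open>A\<close> the pairing
  \<open>a - c b\<close> is degenerate, hence zero. So each dual pair of summands contributes exactly one
  dimension, and the others contribute none.
\<close>

section \<open>Maps that are linear on a subspace\<close>

lemma linear_on_add: "linear_on s t V f \<Longrightarrow> x \<in> V \<Longrightarrow> y \<in> V \<Longrightarrow> f (x + y) = f x + f y"
  by (simp add: linear_on_def)

lemma linear_on_scale: "linear_on s t V f \<Longrightarrow> x \<in> V \<Longrightarrow> f (s a x) = t a (f x)"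
  by (simp add: linear_on_def)

lemma sum_fun_apply: "(\<Sum>i\<in>I. f i) x = (\<Sum>i\<in>I. f i x)"
  by (induction I rule: infinite_finite_induct) auto

context vector_space_pair
begin

lemma linear_on_zero:
  assumes "linear_on s1 s2 V f" and "x \<in> V"
  shows "f 0 = 0"
  using linear_on_scale[OF assms, of 0] by simp

lemma linear_on_diff:
  assumes f: "linear_on s1 s2 V f" and V: "vs1.subspace V" and "x \<in> V" "y \<in> V"
  shows "f (x - y) = f x - f y"
  using linear_on_add[OF f, of "x - y" y] assms vs1.subspace_diff by simp

lemma linear_on_sum:
  assumes f: "linear_on s1 s2 V f" and V: "vs1.subspace V" and "\<And>i. i \<in> I \<Longrightarrow> v i \<in> V"
  shows "f (\<Sum>i\<in>I. v i) = (\<Sum>i\<in>I. f (v i))"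
  using assms(3)
proof (induction I rule: infinite_finite_induct)
  case (insert i I)
  then show ?case
    using linear_on_add[OF f, of "v i" "sum v I"] vs1.subspace_sum[OF V, of I v] by auto
qed (use linear_on_zero[OF f vs1.subspace_0[OF V]] in auto)

text \<open>A basis of \<open>V\<close> extends \<open>f\<close> to a map that is linear on the
  whole ambient space. This makes the theory of \<open>Vector_Spaces.linear\<close> applicable to
  maps that are controlled only on \<open>V\<close>.\<close>

lemma linear_on_extends:
  assumes f: "linear_on s1 s2 V f" and V: "vs1.subspace V"
  obtains g where "Vector_Spaces.linear s1 s2 g" "\<And>x. x \<in> V \<Longrightarrow> g x = f x"
proof -
  obtain B where B: "B \<subseteq> V" "vs1.independent B" "V \<subseteq> vs1.span B"
    by (rule vs1.maximal_independent_subset)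
  obtain g where g: "Vector_Spaces.linear s1 s2 g" "\<forall>x\<in>B. g x = f x"
    using linear_independent_extend[OF B(2)] by blast
  interpret g: Vector_Spaces.linear s1 s2 g by fact
  \<comment> \<open>Membership in \<open>V\<close> is carried through the induction because
    \<open>f\<close> respects sums and multiples only there.\<close>
  have "x \<in> V \<and> g x = f x" if "x \<in> vs1.span B" for x
    using that
  proof (induction rule: vs1.span_induct_alt)
    case base
    show ?case
      using linear_on_zero[OF f vs1.subspace_0[OF V]] vs1.subspace_0[OF V] by (simp add: g.zero)
  next
    case (step c x y)
    then have "x \<in> V" "s1 c x \<in> V" "y \<in> V"
      using B V vs1.subspace_scale by blast+
    then show ?case
      using step g(2) vs1.subspace_add[OF V]
      by (simp add: g.add g.scale linear_on_add[OF f] linear_on_scale[OF f])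
  qed
  with that g(1) B(3) show ?thesis by blast
qed

text \<open>The global extension of \<open>f\<close> is injective on \<open>span B\<close>, which
  lies in \<open>V\<close>, and it has the same image on \<open>B\<close>.\<close>

lemma independent_linear_on_image:
  assumes f: "linear_on s1 s2 V f" and V: "vs1.subspace V" and inj: "inj_on f V"
    and B: "B \<subseteq> V" "vs1.independent B"
  shows "vs2.independent (f ` B)"
proof -
  obtain g where g: "Vector_Spaces.linear s1 s2 g" "\<And>x. x \<in> V \<Longrightarrow> g x = f x"
    using linear_on_extends[OF f V] by blast
  have "vs1.span B \<subseteq> V"
    using B(1) V by (rule vs1.span_minimal)
  then have "inj_on g (vs1.span B)"
    using inj g(2) by (auto simp: inj_on_def subset_eq)
  then have "vs2.independent (g ` B)"
    by (rule linear_independent_injective_image[OF g(1) B(2)])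
  moreover have "g ` B = f ` B"
    using B(1) g(2) by (intro image_cong) auto
  ultimately show ?thesis by simp
qed

lemma subspace_linear_on_image:
  assumes f: "linear_on s1 s2 V f" and V: "vs1.subspace V"
  shows "vs2.subspace (f ` V)"
proof (rule vs2.subspaceI)
  show "0 \<in> f ` V"
    using linear_on_zero[OF f vs1.subspace_0[OF V]] vs1.subspace_0[OF V] by (metis imageI)
  show "x + y \<in> f ` V" if "x \<in> f ` V" "y \<in> f ` V" for x y
    using that vs1.subspace_add[OF V] by (auto simp flip: linear_on_add[OF f])
  show "s2 c x \<in> f ` V" if "x \<in> f ` V" for c x
    using that vs1.subspace_scale[OF V] by (auto simp flip: linear_on_scale[OF f])
qed

lemma inj_on_linear_onI:
  assumes f: "linear_on s1 s2 V f" and V: "vs1.subspace V"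
    and "\<And>x. x \<in> V \<Longrightarrow> f x = 0 \<Longrightarrow> x = 0"
  shows "inj_on f V"
proof (rule inj_onI)
  fix x y assume "x \<in> V" "y \<in> V" "f x = f y"
  then have "f (x - y) = 0" "x - y \<in> V"
    using linear_on_diff[OF f V] vs1.subspace_diff[OF V] by auto
  then show "x = y" using assms(3) by force
qed

lemma linear_on_inv_into:
  assumes f: "linear_on s1 s2 V f" and V: "vs1.subspace V" and bij: "bij_betw f V U"
  shows "linear_on s2 s1 U (inv_into V f)"
proof -
  have *: "inv_into V f y \<in> V" "f (inv_into V f y) = y" if "y \<in> U" for y
    using that bij by (auto simp: bij_betw_def inv_into_into f_inv_into_f)
  have **: "inv_into V f y = x" if "x \<in> V" "f x = y" for x y
    using that bij by (auto simp: bij_betw_def)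
  show ?thesis
    unfolding linear_on_def
    using * vs1.subspace_add[OF V] vs1.subspace_scale[OF V]
    by (auto intro!: ** simp: linear_on_add[OF f] linear_on_scale[OF f])
qed

end

section \<open>Existence of eigenvectors on finite-dimensional subspaces\<close>

text \<open>This is the vector \<open>p(A) v\<close>. It is formed from the iterates of
  \<open>A\<close> at \<open>v\<close>, so \<open>A\<close> may be an arbitrary function that is
  linear only on a subspace.\<close>

definition poly_apply ::
  "('f::field \<Rightarrow> 'v::ab_group_add \<Rightarrow> 'v) \<Rightarrow> 'f poly \<Rightarrow> ('v \<Rightarrow> 'v) \<Rightarrow> 'v \<Rightarrow> 'v"
  where "poly_apply s p A v = (\<Sum>i\<le>degree p. s (coeff p i) ((A ^^ i) v))"

context vector_space
begin

lemma poly_apply_eq_sum: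
  fixes p :: "'a poly"
  shows "degree p \<le> n \<Longrightarrow> poly_apply scale p A v = (\<Sum>i\<le>n. coeff p i *s (A ^^ i) v)"
  unfolding poly_apply_def by (rule sum.mono_neutral_left) (auto simp: coeff_eq_0)

text \<open>The iterates of \<open>A\<close> commute with \<open>A - c\<close> on \<open>U\<close>,
  so \<open>(X - c) q\<close> evaluated at \<open>A\<close> is \<open>q(A)\<close> applied after
  \<open>A - c\<close>. This allows roots of an annihilating polynomial to be split off one at a
  time.\<close>

lemma poly_apply_linear_factor:
  fixes q :: "'a poly"
  assumes A: "linear_on scale scale U A" and U: "subspace U" and AU: "\<And>x. x \<in> U \<Longrightarrow> A x \<in> U"
    and v: "v \<in> U"
  shows "poly_apply scale ([:-c, 1:] * q) A v = poly_apply scale q A (A v - c *s v)"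
proof -
  interpret P: vector_space_pair scale scale by unfold_locales
  have pow: "(A ^^ i) x \<in> U" if "x \<in> U" for i x
    using that AU by (induction i) auto
  have lin: "(A ^^ i) (A v - c *s v) = (A ^^ Suc i) v - c *s (A ^^ i) v" for i
  proof (induction i)
    case (Suc i)
    then show ?case
      using v pow AU subspace_scale[OF U]
      by (simp add: P.linear_on_diff[OF A U] linear_on_scale[OF A])
  qed simp
  have q: "coeff q (Suc (degree q)) = 0"
    by (simp add: coeff_eq_0)
  have "degree ([:-c, 1:] * q) \<le> Suc (degree q)"
    using degree_mult_le[of "[:-c, 1:]" q] by simp
  then have "poly_apply scale ([:-c, 1:] * q) A v
      = (\<Sum>i\<le>Suc (degree q). coeff ([:-c, 1:] * q) i *s (A ^^ i) v)"
    by (rule poly_apply_eq_sum)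
  \<comment> \<open>\<open>pCons 0 q\<close> is \<open>X * q\<close>, so the product is
    \<open>X * q\<close> minus \<open>c\<close> times \<open>q\<close>. At the top index
    \<open>Suc (degree q)\<close> only \<open>X * q\<close> contributes; the shift of its sum
    produces the extra power of \<open>A\<close>.\<close>
  also have "\<dots> = (\<Sum>i\<le>Suc (degree q). coeff (pCons 0 q) i *s (A ^^ i) v)
      - (\<Sum>i\<le>Suc (degree q). (c * coeff q i) *s (A ^^ i) v)"
    unfolding sum_subtractf[symmetric]
    by (rule sum.cong) (simp_all add: scale_left_diff_distrib)
  also have "(\<Sum>i\<le>Suc (degree q). coeff (pCons 0 q) i *s (A ^^ i) v)
      = (\<Sum>i\<le>degree q. coeff q i *s (A ^^ Suc i) v)"
    by (subst sum.atMost_Suc_shift) simp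
  also have "(\<Sum>i\<le>Suc (degree q). (c * coeff q i) *s (A ^^ i) v)
      = (\<Sum>i\<le>degree q. (c * coeff q i) *s (A ^^ i) v)"
    using q by simp
  also have "(\<Sum>i\<le>degree q. coeff q i *s (A ^^ Suc i) v) - \<dots> = poly_apply scale q A (A v - c *s v)"
    unfolding poly_apply_def lin sum_subtractf[symmetric]
    by (rule sum.cong) (simp_all add: scale_right_diff_distrib mult.commute)
  finally show ?thesis .
qed

text \<open>With \<open>n = card B\<close>, the \<open>n + 1\<close> vectors \<open>v\<close>,
  \<open>A v\<close>, ..., \<open>A^n v\<close> lie in the span of \<open>n\<close> vectors and
  satisfy a nontrivial linear relation. Its coefficients are those of \<open>p\<close>.\<close>

lemma poly_apply_annihilator:
  assumes "finite B" and A: "\<And>x. x \<in> span B \<Longrightarrow> A x \<in> span B" and v: "v \<in> span B"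
  obtains p where "p \<noteq> 0" "poly_apply scale p A v = 0"
proof -
  define n where "n = card B"
  let ?f = "\<lambda>i. (A ^^ i) v"
  have in_span: "?f i \<in> span B" for i
    using v A by (induction i) auto
  have "\<exists>c. (\<exists>i\<le>n. c i \<noteq> 0) \<and> (\<Sum>i\<le>n. c i *s ?f i) = 0"
  \<comment> \<open>\<open>dependent\<close> is a notion for sets and does not see repetitions. If
    two iterates coincide, their difference is the relation, with coefficients 1 and -1.\<close>
  proof (cases "inj_on ?f {..n}")
    case True
    have "\<not> independent (?f ` {..n})"
    proof
      assume "independent (?f ` {..n})"
      then have "card (?f ` {..n}) \<le> card B"
        using independent_span_bound[OF \<open>finite B\<close>] in_span by blast
      then show False using card_image[OF True] by (simp add: n_def)
    qed
    then obtain u where u: "(\<Sum>x\<in>?f ` {..n}. u x *s x) = 0" "\<exists>x\<in>?f ` {..n}. u x \<noteq> 0"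
      by (auto simp: dependent_finite)
    then show ?thesis
      using True by (intro exI[of _ "u \<circ> ?f"]) (auto simp: sum.reindex)
  next
    case False
    then obtain i j where ij: "i \<le> n" "j \<le> n" "i \<noteq> j" "?f i = ?f j"
      by (auto simp: inj_on_def)
    let ?c = "\<lambda>l. if l = i then 1 else if l = j then - 1 else 0"
    have "(\<Sum>l\<le>n. ?c l *s ?f l) = (\<Sum>l\<in>{i, j}. ?c l *s ?f l)"
      using ij by (intro sum.mono_neutral_right) auto
    also have "\<dots> = 0"
      using ij by simp
    finally show ?thesis
      using ij by (intro exI[of _ ?c]) auto
  qed
  then obtain c i where c: "i \<le> n" "c i \<noteq> 0" "(\<Sum>i\<le>n. c i *s ?f i) = 0"
    by blast
  define p where "p = (\<Sum>i\<le>n. monom (c i) i)"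
  have coeff: "coeff p j = (if j \<le> n then c j else 0)" for j
    by (simp add: p_def coeff_sum)
  have "degree p \<le> n"
    by (rule degree_le) (simp add: coeff)
  then have "poly_apply scale p A v = (\<Sum>i\<le>n. c i *s ?f i)"
    by (simp add: poly_apply_eq_sum coeff)
  moreover have "p \<noteq> 0"
    using c coeff[of i] by auto
  ultimately show ?thesis
    using that c by auto
qed

end

text \<open>Induction on the degree: a root \<open>c\<close> gives \<open>p = (X - c) q\<close>.
  Either \<open>A v = c v\<close>, and \<open>v\<close> is an eigenvector, or
  \<open>A v - c v\<close> is a nonzero vector of \<open>U\<close> annihilated by \<open>q\<close>,
  which has smaller degree.\<close>

lemma eigenvector_of_annihilator:
  fixes s :: "'f::alg_closed_field \<Rightarrow> 'v::ab_group_add \<Rightarrow> 'v"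
  assumes "vector_space s"
    and A: "linear_on s s U A" and U: "module.subspace s U" and AU: "\<And>x. x \<in> U \<Longrightarrow> A x \<in> U"
    and "v \<in> U" "v \<noteq> 0" "p \<noteq> 0" "poly_apply s p A v = 0"
  shows "\<exists>c. \<exists>x\<in>U. x \<noteq> 0 \<and> A x = s c x"
  using assms(5-)
proof (induction "degree p" arbitrary: p v rule: less_induct)
  case less
  interpret vector_space s by fact
  show ?case
  proof (cases "degree p = 0")
    \<comment> \<open>A nonzero constant polynomial cannot annihilate the nonzero vector
      \<open>v\<close>, so this case is contradictory.\<close>
    case True
    then show ?thesis
      using less.prems by (auto elim!: degree_eq_zeroE simp: poly_apply_def)
  next
    case False
    then obtain c where "poly p c = 0"
      using alg_closed_imp_poly_has_root[of p] by blast
    then obtain q where p: "p = [:-c, 1:] * q"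
      using poly_eq_0_iff_dvd dvdE by metis
    then have q: "q \<noteq> 0"
      using less.prems by auto
    then have "degree p = Suc (degree q)"
      unfolding p by (subst degree_mult_eq) auto
    moreover have "poly_apply s q A (A v - s c v) = 0"
      using less.prems poly_apply_linear_factor[OF A U AU] p by simp
    moreover have "A v - s c v \<in> U"
      using less.prems AU subspace_scale[OF U] subspace_diff[OF U] by blast
    ultimately show ?thesis
      using less.hyps[of q "A v - s c v"] less.prems q by (cases "A v = s c v") auto
  qed
qed

lemma eigenvector_exists:
  fixes s :: "'f::alg_closed_field \<Rightarrow> 'v::ab_group_add \<Rightarrow> 'v"
  assumes s: "vector_space s" and A: "linear_on s s U A" and U: "module.subspace s U"
    and AU: "\<And>x. x \<in> U \<Longrightarrow> A x \<in> U"
    and fin: "finite B" "module.span s B = U" and "U \<noteq> {0}"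
  obtains c x where "x \<in> U" "x \<noteq> 0" "A x = s c x"
proof -
  interpret vector_space s by fact
  obtain v where v: "v \<in> U" "v \<noteq> 0"
    using \<open>U \<noteq> {0}\<close> subspace_0[OF U] by auto
  obtain p where p: "p \<noteq> 0" "poly_apply s p A v = 0"
    using poly_apply_annihilator[OF fin(1), of A v] fin(2) AU v by metis
  show ?thesis
    using eigenvector_of_annihilator[OF s A U AU v p] that by blast
qed

section \<open>Dual spaces and nondegenerate bilinear pairings\<close>

text \<open>The coordinate functionals of \<open>B\<close> span the dual space, since a functional
  is determined by its values on \<open>B\<close>; an independent set is no larger than a finite
  spanning set.\<close>

lemma dual_space_independent_bound:
  fixes s :: "'f::field \<Rightarrow> 'v::ab_group_add \<Rightarrow> 'v"
  assumes "vector_space s" and B: "finite B" "\<not> module.dependent s B" "module.span s B = V"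
    and S: "\<not> module.dependent (fun_scale (*)) S" "S \<subseteq> dual_space s V"
  shows "finite S \<and> card S \<le> card B"
proof -
  interpret vector_space s by fact
  interpret D: vector_space "fun_scale (*) :: 'f \<Rightarrow> ('v \<Rightarrow> 'f) \<Rightarrow> 'v \<Rightarrow> 'f"
    by (intro vector_space_fun_scale vector_space_field)
  interpret F: vector_space_pair s "(*)"
    by (simp add: vector_space_pair_def vector_space_axioms vector_space_field)
  define C where "C e = (\<lambda>x. if x \<in> V then representation B x e else 0)" for e
  have V: "subspace V"
    using B(3) subspace_span by blast
  have "\<phi> \<in> D.span (C ` B)" if "\<phi> \<in> dual_space s V" for \<phi>
  proof -
    have lin: "linear_on s (*) V \<phi>" and out: "\<And>x. x \<notin> V \<Longrightarrow> \<phi> x = 0"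
      using that by (auto simp: dual_space_def)
    have "\<phi> x = (\<Sum>e\<in>B. \<phi> e * C e x)" for x
    proof (cases "x \<in> V")
      case True
      have "\<phi> x = \<phi> (\<Sum>e\<in>B. s (representation B x e) e)"
        using B True by (simp add: sum_representation_eq)
      also have "\<dots> = (\<Sum>e\<in>B. \<phi> (s (representation B x e) e))"
        using B(3) span_base by (intro F.linear_on_sum[OF lin V] subspace_scale[OF V]) blast
      also have "\<dots> = (\<Sum>e\<in>B. \<phi> e * C e x)"
      proof (rule sum.cong)
        fix e assume "e \<in> B"
        then have "e \<in> V" using B(3) span_base by blast
        then show "\<phi> (s (representation B x e) e) = \<phi> e * C e x"
          using True by (simp add: linear_on_scale[OF lin] C_def)
      qed simp
      finally show ?thesis .
    qed (simp add: C_def out)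
    then have "\<phi> = (\<Sum>e\<in>B. fun_scale (*) (\<phi> e) (C e))"
      unfolding fun_eq_iff sum_fun_apply fun_scale_def by blast
    also have "\<dots> \<in> D.span (C ` B)"
      by (intro D.span_sum D.span_scale D.span_base) auto
    finally show ?thesis .
  qed
  then have "finite S \<and> card S \<le> card (C ` B)"
    using S B(1) by (intro D.independent_span_bound) auto
  then show ?thesis
    using card_image_le[OF B(1), of C] by linarith
qed

text \<open>\<open>finite_dim\<close> supplies a finite spanning set, whereas the dimension
  comparisons below count elements of bases.\<close>

lemma (in vector_space) finite_basis_of_finite_span:
  assumes "finite B" "span B = V"
  obtains C where "finite C" "independent C" "span C = V"
proof -
  obtain C where C: "C \<subseteq> V" "independent C" "V \<subseteq> span C"
    by (rule maximal_independent_subset)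
  then have "finite C"
    using independent_span_bound[OF assms(1)] assms(2) by blast
  moreover have "span C = V"
    using C assms(2) span_minimal[of C V] by (auto intro: subspace_span)
  ultimately show ?thesis
    using that C(2) by blast
qed

text \<open>In contrast to \<open>bilinear_forms\<close>, the two spaces may differ and no values
  are prescribed outside them, so the notion is stable under exchanging the arguments and under
  composition with linear maps.\<close>

definition bilinear_on ::
  "('f::field \<Rightarrow> 'v::ab_group_add \<Rightarrow> 'v) \<Rightarrow> 'v set \<Rightarrow> ('f \<Rightarrow> 'w::ab_group_add \<Rightarrow> 'w) \<Rightarrow> 'w set
    \<Rightarrow> ('v \<Rightarrow> 'w \<Rightarrow> 'f) \<Rightarrow> bool"
  where "bilinear_on t W u U b \<longleftrightarrow>
    (\<forall>x\<in>W. linear_on u (*) U (b x)) \<and> (\<forall>y\<in>U. linear_on t (*) W (\<lambda>x. b x y))"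

lemma bilinear_on_flip: "bilinear_on t W u U b \<Longrightarrow> bilinear_on u U t W (\<lambda>y x. b x y)"
  by (simp add: bilinear_on_def)

lemma bilinear_on_compose:
  assumes b: "bilinear_on t W u U b"
    and f: "linear_on t' t W' f" "f ` W' \<subseteq> W" and h: "linear_on u' u U' h" "h ` U' \<subseteq> U"
  shows "bilinear_on t' W' u' U' (\<lambda>x y. b (f x) (h y))"
  using assms by (simp add: bilinear_on_def linear_on_def image_subset_iff)

lemma bilinear_on_zero:
  assumes "vector_space t" "vector_space u" and b: "bilinear_on t W u U b"
  shows "x \<in> W \<Longrightarrow> module.subspace u U \<Longrightarrow> b x 0 = 0"
    and "y \<in> U \<Longrightarrow> module.subspace t W \<Longrightarrow> b 0 y = 0"
proof -
  interpret t: vector_space t by fact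
  interpret u: vector_space u by fact
  interpret P: vector_space_pair t "(*) :: 'a \<Rightarrow> 'a \<Rightarrow> 'a"
    by (simp add: vector_space_pair_def t.vector_space_axioms vector_space_field)
  interpret Q: vector_space_pair u "(*) :: 'a \<Rightarrow> 'a \<Rightarrow> 'a"
    by (simp add: vector_space_pair_def u.vector_space_axioms vector_space_field)
  show "b x 0 = 0" if "x \<in> W" "module.subspace u U"
    using that b Q.linear_on_zero u.subspace_0 unfolding bilinear_on_def by blast
  show "b 0 y = 0" if "y \<in> U" "module.subspace t W"
    using that b P.linear_on_zero[of W "\<lambda>x. b x y"] t.subspace_0 unfolding bilinear_on_def by blast
qed

text \<open>The map from \<open>U\<close> to the dual of \<open>W\<close> induced by a pairing, cut
  off outside \<open>W\<close> to meet the convention of \<open>dual_space\<close>.\<close>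

definition functional_of :: "'v set \<Rightarrow> ('v \<Rightarrow> 'w \<Rightarrow> 'f::field) \<Rightarrow> 'w \<Rightarrow> 'v \<Rightarrow> 'f"
  where "functional_of W b y = (\<lambda>x. if x \<in> W then b x y else 0)"

lemma functional_of_in_dual_space:
  assumes "vector_space t" "module.subspace t W" and b: "bilinear_on t W u U b" and y: "y \<in> U"
  shows "functional_of W b y \<in> dual_space t W"
proof -
  interpret vector_space t by fact
  show ?thesis
    using assms subspace_add[OF assms(2)] subspace_scale[OF assms(2)]
    by (simp add: dual_space_def functional_of_def bilinear_on_def linear_on_def)
qed

lemma linear_on_functional_of:
  "bilinear_on t W u U b \<Longrightarrow> linear_on u (fun_scale (*)) U (functional_of W b)"
  by (auto simp: linear_on_def bilinear_on_def functional_of_def fun_scale_def fun_eq_iff)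

lemma inj_on_functional_of:
  assumes "vector_space u" "module.subspace u U" and b: "bilinear_on t W u U b"
    and nondeg: "\<And>y. y \<in> U \<Longrightarrow> (\<forall>x\<in>W. b x y = 0) \<Longrightarrow> y = 0"
  shows "inj_on (functional_of W b) U"
proof -
  interpret vector_space_pair u "fun_scale (*) :: 'a \<Rightarrow> ('d \<Rightarrow> 'a) \<Rightarrow> 'd \<Rightarrow> 'a"
    by (simp add: vector_space_pair_def assms(1) vector_space_fun_scale vector_space_field)
  show ?thesis
  proof (rule inj_on_linear_onI[OF linear_on_functional_of[OF b] assms(2)])
    fix y assume "y \<in> U" "functional_of W b y = 0"
    then show "y = 0"
      by (intro nondeg) (auto simp: functional_of_def fun_eq_iff split: if_splits)
  qed
qed

text \<open>Nondegeneracy in the second argument makes \<open>functional_of W b\<close> injective,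
  so it carries a basis of \<open>U\<close> to equally many independent functionals on
  \<open>W\<close>.\<close>

lemma nondegenerate_card_le:
  assumes t: "vector_space t" and u: "vector_space u" and b: "bilinear_on t W u U b"
    and B: "finite B" "\<not> module.dependent t B" "module.span t B = W"
    and C: "finite C" "\<not> module.dependent u C" "module.span u C = U"
    and nondeg: "\<And>y. y \<in> U \<Longrightarrow> (\<forall>x\<in>W. b x y = 0) \<Longrightarrow> y = 0"
  shows "\<not> module.dependent (fun_scale (*)) (functional_of W b ` C)"
    and "card (functional_of W b ` C) = card C" and "card C \<le> card B"
proof -
  interpret t: vector_space t by fact
  interpret u: vector_space u by fact
  interpret vector_space_pair u "fun_scale (*) :: 'a \<Rightarrow> ('b \<Rightarrow> 'a) \<Rightarrow> 'b \<Rightarrow> 'a"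
    by (simp add: vector_space_pair_def u vector_space_fun_scale vector_space_field)
  have W: "t.subspace W" and U: "u.subspace U" and CU: "C \<subseteq> U"
    using B(3) C(3) t.subspace_span u.subspace_span u.span_superset by blast+
  have inj: "inj_on (functional_of W b) U"
    by (rule inj_on_functional_of[OF u U b nondeg])
  show ind: "vs2.independent (functional_of W b ` C)"
    by (rule independent_linear_on_image[OF linear_on_functional_of[OF b] U inj CU C(2)])
  show "card (functional_of W b ` C) = card C"
    using inj CU by (meson card_image inj_on_subset)
  moreover have "functional_of W b ` C \<subseteq> dual_space t W"
    using functional_of_in_dual_space[OF t W b] CU by blast
  ultimately show "card C \<le> card B"
    using dual_space_independent_bound[OF t B ind] by simp
qed

text \<open>A basis \<open>C'\<close> of \<open>U\<close> yields \<open>card C'\<close> independent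
  functionals, while the flipped pairing gives \<open>card B' \<le> card C'\<close> for a basis
  \<open>B'\<close> of \<open>W\<close>. A functional outside their span would enlarge them to an
  independent set of more than \<open>card B'\<close> functionals.\<close>

lemma nondegenerate_represents_functional:
  assumes t: "vector_space t" and u: "vector_space u" and b: "bilinear_on t W u U b"
    and finW: "finite B" "module.span t B = W" and finU: "finite C" "module.span u C = U"
    and nondegW: "\<And>x. x \<in> W \<Longrightarrow> (\<forall>y\<in>U. b x y = 0) \<Longrightarrow> x = 0"
    and nondegU: "\<And>y. y \<in> U \<Longrightarrow> (\<forall>x\<in>W. b x y = 0) \<Longrightarrow> y = 0"
  shows "functional_of W b ` U = dual_space t W"
proof
  interpret t: vector_space t by fact
  interpret u: vector_space u by fact
  interpret vector_space_pair u "fun_scale (*) :: 'a \<Rightarrow> ('b \<Rightarrow> 'a) \<Rightarrow> 'b \<Rightarrow> 'a"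
    by (simp add: vector_space_pair_def u vector_space_fun_scale vector_space_field)
  obtain B' where B': "finite B'" "t.independent B'" "t.span B' = W"
    using t.finite_basis_of_finite_span[OF finW] by blast
  obtain C' where C': "finite C'" "u.independent C'" "u.span C' = U"
    using u.finite_basis_of_finite_span[OF finU] by blast
  have W: "t.subspace W" and U: "u.subspace U" and CU: "C' \<subseteq> U"
    using B'(3) C'(3) t.subspace_span u.subspace_span u.span_superset by blast+
  show sub: "functional_of W b ` U \<subseteq> dual_space t W"
    using functional_of_in_dual_space[OF t W b] by blast
  note card_le = nondegenerate_card_le[OF t u b B' C' nondegU]
  have "card B' \<le> card C'"
    using nondegenerate_card_le(3)[OF u t bilinear_on_flip[OF b] C' B' nondegW] by blast
  let ?S = "functional_of W b ` C'"
  show "dual_space t W \<subseteq> functional_of W b ` U"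
  proof
    fix \<phi> assume \<phi>: "\<phi> \<in> dual_space t W"
    have "\<phi> \<in> vs2.span ?S"
    proof (rule ccontr)
      assume notin: "\<phi> \<notin> vs2.span ?S"
      have "vs2.independent (insert \<phi> ?S)"
        by (rule vs2.independent_insertI[OF notin card_le(1)])
      moreover have "\<phi> \<notin> ?S"
        using notin vs2.span_base by blast
      moreover have "insert \<phi> ?S \<subseteq> dual_space t W"
        using \<phi> sub CU by blast
      ultimately have "card (insert \<phi> ?S) \<le> card B'" "card (insert \<phi> ?S) = Suc (card C')"
        using dual_space_independent_bound[OF t B', of "insert \<phi> ?S"] card_le(2) C'(1) by simp_all
      then show False
        using \<open>card B' \<le> card C'\<close> by simp
    qed
    also have "vs2.span ?S \<subseteq> functional_of W b ` U"
      using CU subspace_linear_on_image[OF linear_on_functional_of[OF b] U]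
      by (intro vs2.span_minimal) auto
    finally show "\<phi> \<in> functional_of W b ` U" .
  qed
qed

section \<open>Group representations and invariant pairings\<close>

context group_representation
begin

lemma rep_in_Bij: "g \<in> carrier G \<Longrightarrow> \<rho> g \<in> Bij V"
  and linear_on_rep: "g \<in> carrier G \<Longrightarrow> linear_on s s V (\<rho> g)"
  using hom by (auto simp: hom_def GL_def Pi_iff)

lemma rep_closed: "g \<in> carrier G \<Longrightarrow> x \<in> V \<Longrightarrow> \<rho> g x \<in> V"
  using rep_in_Bij by (auto simp: Bij_def bij_betw_def)

lemma rep_mult:
  assumes "g \<in> carrier G" "h \<in> carrier G" "x \<in> V"
  shows "\<rho> (g \<otimes> h) x = \<rho> g (\<rho> h x)"
  using hom assms rep_in_Bij by (auto simp: hom_def GL_def BijGroup_def compose_def)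

text \<open>Membership in \<open>hom\<close> states multiplicativity only. It makes
  \<open>\<rho> \<one>\<close> idempotent on \<open>V\<close>, and an injective idempotent map is
  the identity.\<close>

lemma rep_one:
  assumes "x \<in> V"
  shows "\<rho> \<one> x = x"
proof -
  have "\<rho> \<one> (\<rho> \<one> x) = \<rho> \<one> x"
    using rep_mult[of \<one> \<one> x] assms by simp
  moreover have "inj_on (\<rho> \<one>) V"
    using rep_in_Bij[of \<one>] by (simp add: Bij_def bij_betw_def)
  ultimately show ?thesis
    using assms rep_closed[of \<one> x] by (simp add: inj_on_eq_iff)
qed

lemma rep_inv_right: "g \<in> carrier G \<Longrightarrow> x \<in> V \<Longrightarrow> \<rho> g (\<rho> (inv g) x) = x"
  and rep_inv_left: "g \<in> carrier G \<Longrightarrow> x \<in> V \<Longrightarrow> \<rho> (inv g) (\<rho> g x) = x"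
  by (simp_all flip: rep_mult add: rep_one)

end

text \<open>For representations this amounts to an equivariant linear map from \<open>U\<close> to
  the dual of \<open>W\<close>. In the form of a pairing, the roles of \<open>W\<close> and
  \<open>U\<close> can be exchanged.\<close>

definition invariant_pairing ::
  "('g, 'm) monoid_scheme
    \<Rightarrow> ('f::field \<Rightarrow> 'v::ab_group_add \<Rightarrow> 'v) \<Rightarrow> 'v set \<Rightarrow> ('g \<Rightarrow> 'v \<Rightarrow> 'v)
    \<Rightarrow> ('f \<Rightarrow> 'w::ab_group_add \<Rightarrow> 'w) \<Rightarrow> 'w set \<Rightarrow> ('g \<Rightarrow> 'w \<Rightarrow> 'w) \<Rightarrow> ('v \<Rightarrow> 'w \<Rightarrow> 'f) \<Rightarrow> bool"
  where "invariant_pairing G t W \<sigma> u U \<tau> b \<longleftrightarrow> bilinear_on t W u U b \<and>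
    (\<forall>g\<in>carrier G. \<forall>x\<in>W. \<forall>y\<in>U. b (\<sigma> g x) (\<tau> g y) = b x y)"

lemma invariant_pairing_flip:
  "invariant_pairing G t W \<sigma> u U \<tau> b \<Longrightarrow> invariant_pairing G u U \<tau> t W \<sigma> (\<lambda>y x. b x y)"
  by (simp add: invariant_pairing_def bilinear_on_flip)

lemma invariant_pairing_diff_scale:
  assumes "invariant_pairing G t W \<sigma> u U \<tau> a" "invariant_pairing G t W \<sigma> u U \<tau> b"
  shows "invariant_pairing G t W \<sigma> u U \<tau> (\<lambda>x y. a x y - c * b x y)"
  using assms
  by (auto simp: invariant_pairing_def bilinear_on_def linear_on_def algebra_simps)

text \<open>Used in both directions: to restrict an invariant form to a pair of summands along the
  embeddings, and to pull a pairing of summands back along the projections.\<close>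

lemma invariant_pairing_compose:
  assumes b: "invariant_pairing G t W \<sigma> u U \<tau> b"
    and f: "linear_on t' t W' f" "f ` W' \<subseteq> W"
      "\<And>g x. g \<in> carrier G \<Longrightarrow> x \<in> W' \<Longrightarrow> f (\<sigma>' g x) = \<sigma> g (f x)"
    and h: "linear_on u' u U' h" "h ` U' \<subseteq> U"
      "\<And>g x. g \<in> carrier G \<Longrightarrow> x \<in> U' \<Longrightarrow> h (\<tau>' g x) = \<tau> g (h x)"
  shows "invariant_pairing G t' W' \<sigma>' u' U' \<tau>' (\<lambda>x y. b (f x) (h y))"
proof -
  have "bilinear_on t W u U b"
    using b by (simp add: invariant_pairing_def)
  then have "bilinear_on t' W' u' U' (\<lambda>x y. b (f x) (h y))"
    using f(1,2) h(1,2) by (rule bilinear_on_compose)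
  moreover have "b (f (\<sigma>' g x)) (h (\<tau>' g y)) = b (f x) (h y)"
    if "g \<in> carrier G" "x \<in> W'" "y \<in> U'" for g x y
  proof -
    have "f x \<in> W" "h y \<in> U"
      using f(2) h(2) that by auto
    then show ?thesis
      using b that by (simp add: f(3) h(3) invariant_pairing_def)
  qed
  ultimately show ?thesis
    by (simp add: invariant_pairing_def)
qed

text \<open>The right kernel of an invariant pairing is a subrepresentation.\<close>

lemma degenerate_invariant_pairing:
  assumes \<sigma>: "group_representation G t W \<sigma>" and \<tau>: "irreducible_representation G u U \<tau>"
    and b: "invariant_pairing G t W \<sigma> u U \<tau> b"
    and z: "z \<in> U" "z \<noteq> 0" "\<forall>x\<in>W. b x z = 0"
    and xy: "x \<in> W" "y \<in> U"
  shows "b x y = 0"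
proof -
  interpret \<sigma>: group_representation G t W \<sigma> by fact
  interpret \<tau>: irreducible_representation G u U \<tau> by fact
  note bil = b[unfolded invariant_pairing_def, THEN conjunct1]
  have lin: "linear_on u (*) U (b x)" if "x \<in> W" for x
    using bil that by (simp add: bilinear_on_def)
  define K where "K = {y\<in>U. \<forall>x\<in>W. b x y = 0}"
  have "K = {0} \<or> K = U"
  proof (rule \<tau>.irreducible)
    show "\<tau>.subspace K"
      using \<tau>.subspace_V \<tau>.subspace_0 \<tau>.subspace_add \<tau>.subspace_scale
        bilinear_on_zero(1)[OF \<sigma>.vector_space_axioms \<tau>.vector_space_axioms bil]
      by (intro \<tau>.subspaceI) (auto simp: K_def linear_on_add[OF lin] linear_on_scale[OF lin])
    show "\<forall>g\<in>carrier G. \<tau> g ` K \<subseteq> K"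
    proof safe
      fix g y assume g: "g \<in> carrier G" and y: "y \<in> K"
      \<comment> \<open>Writing \<open>x\<close> as \<open>\<sigma> g (\<sigma> (inv g) x)\<close>
        lets invariance remove \<open>g\<close> from both arguments.\<close>
      have "b x (\<tau> g y) = 0" if "x \<in> W" for x
      proof -
        have "b (\<sigma> g (\<sigma> (inv\<^bsub>G\<^esub> g) x)) (\<tau> g y) = b (\<sigma> (inv\<^bsub>G\<^esub> g) x) y"
          using b g y that \<sigma>.rep_closed by (auto simp: invariant_pairing_def K_def)
        then show ?thesis
          using g y that \<sigma>.rep_closed by (simp add: \<sigma>.rep_inv_right K_def)
      qed
      then show "\<tau> g y \<in> K"
        using g y \<tau>.rep_closed by (auto simp: K_def)
    qed
  qed (auto simp: K_def)
  moreover have "z \<in> K"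
    using z by (simp add: K_def)
  ultimately show ?thesis
    using z(2) xy unfolding K_def by blast
qed

section \<open>Schur's lemma for pairings\<close>

text \<open>By irreducibility, a single nonzero value forces both kernels to vanish. Then
  \<open>functional_of W b\<close> is a bijection onto the dual, and invariance of \<open>b\<close>
  is its equivariance, with the inverse that occurs in \<open>dual_action\<close>.\<close>

lemma isomorphic_dual_of_invariant_pairing:
  assumes \<sigma>: "irreducible_representation G t W \<sigma>" and \<tau>: "irreducible_representation G u U \<tau>"
    and b: "invariant_pairing G t W \<sigma> u U \<tau> b"
    and nz: "x \<in> W" "y \<in> U" "b x y \<noteq> 0"
  shows "isomorphic_rep G u U \<tau> (fun_scale (*)) (dual_space t W) (dual_action G t W \<sigma>)"
proof -
  interpret \<sigma>: irreducible_representation G t W \<sigma> by fact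
  interpret \<tau>: irreducible_representation G u U \<tau> by fact
  have bil: "bilinear_on t W u U b"
    using b by (simp add: invariant_pairing_def)
  obtain B C where fin: "finite B" "\<sigma>.span B = W" "finite C" "\<tau>.span C = U"
    using \<sigma>.finite_dim \<tau>.finite_dim by blast
  have nondegU: "y = 0" if "y \<in> U" "\<forall>x\<in>W. b x y = 0" for y
    using degenerate_invariant_pairing[OF \<sigma>.group_representation_axioms \<tau> b] that nz by blast
  have nondegW: "x = 0" if "x \<in> W" "\<forall>y\<in>U. b x y = 0" for x
    using degenerate_invariant_pairing[OF \<tau>.group_representation_axioms \<sigma> invariant_pairing_flip[OF b]]
      that nz by blast
  have "inj_on (functional_of W b) U"
    using \<tau>.vector_space_axioms \<tau>.subspace_V bil nondegU by (rule inj_on_functional_of)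
  moreover have "functional_of W b ` U = dual_space t W"
    using \<sigma>.vector_space_axioms \<tau>.vector_space_axioms bil fin nondegW nondegU
    by (rule nondegenerate_represents_functional)
  ultimately have "bij_betw (functional_of W b) U (dual_space t W)"
    by (rule bij_betw_imageI)
  moreover have "functional_of W b (\<tau> g y) = dual_action G t W \<sigma> g (functional_of W b y)"
    if g: "g \<in> carrier G" and y: "y \<in> U" for g y
  proof -
    have "b x (\<tau> g y) = b (\<sigma> (inv\<^bsub>G\<^esub> g) x) y" if x: "x \<in> W" for x
    proof -
      have "b (\<sigma> g (\<sigma> (inv\<^bsub>G\<^esub> g) x)) (\<tau> g y) = b (\<sigma> (inv\<^bsub>G\<^esub> g) x) y"
        using b g y x \<sigma>.rep_closed by (auto simp: invariant_pairing_def)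
      then show ?thesis
        using g x by (simp add: \<sigma>.rep_inv_right)
    qed
    then show ?thesis
      using functional_of_in_dual_space[OF \<sigma>.vector_space_axioms \<sigma>.subspace_V bil y] g \<sigma>.rep_closed
      by (auto simp: dual_action_def functional_of_def)
  qed
  ultimately show ?thesis
    using linear_on_functional_of[OF bil] unfolding isomorphic_rep_def by blast
qed

text \<open>An isomorphism \<open>T\<close> onto the dual is read as the pairing
  \<open>b x y = T y x\<close>. Uniqueness up to a scalar is where algebraic closedness enters,
  through an eigenvalue.\<close>

lemma invariant_pairing_of_isomorphic_dual:
  fixes t :: "'f::alg_closed_field \<Rightarrow> 'v::ab_group_add \<Rightarrow> 'v"
    and u :: "'f \<Rightarrow> 'w::ab_group_add \<Rightarrow> 'w"
  assumes \<sigma>: "irreducible_representation G t W \<sigma>" and \<tau>: "irreducible_representation G u U \<tau>"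
    and iso: "isomorphic_rep G u U \<tau> (fun_scale (*)) (dual_space t W) (dual_action G t W \<sigma>)"
  obtains b x y where "invariant_pairing G t W \<sigma> u U \<tau> b" "x \<in> W" "y \<in> U" "b x y \<noteq> 0"
    and "\<And>a. invariant_pairing G t W \<sigma> u U \<tau> a \<Longrightarrow> \<exists>c. \<forall>x\<in>W. \<forall>y\<in>U. a x y = c * b x y"
proof -
  interpret \<sigma>: irreducible_representation G t W \<sigma> by fact
  interpret \<tau>: irreducible_representation G u U \<tau> by fact
  interpret P: vector_space_pair u "fun_scale (*) :: 'f \<Rightarrow> ('v \<Rightarrow> 'f) \<Rightarrow> 'v \<Rightarrow> 'f"
    by (simp add: vector_space_pair_def \<tau>.vector_space_axioms vector_space_fun_scale vector_space_field)
  obtain T where bij: "bij_betw T U (dual_space t W)" and T: "linear_on u (fun_scale (*)) U T"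
    and equi: "\<And>g y. g \<in> carrier G \<Longrightarrow> y \<in> U \<Longrightarrow> T (\<tau> g y) = dual_action G t W \<sigma> g (T y)"
    using iso unfolding isomorphic_rep_def by blast
  define b where "b x y = T y x" for x y
  have T_in: "T y \<in> dual_space t W" if "y \<in> U" for y
    using bij that by (auto simp: bij_betw_def)
  have "b (\<sigma> g x) (\<tau> g y) = b x y" if "g \<in> carrier G" "x \<in> W" "y \<in> U" for g x y
    using that T_in by (simp add: b_def equi dual_action_def \<sigma>.rep_closed \<sigma>.rep_inv_left)
  moreover have "bilinear_on t W u U b"
    using T_in T by (auto simp: bilinear_on_def b_def dual_space_def linear_on_def fun_scale_def)
  ultimately have b: "invariant_pairing G t W \<sigma> u U \<tau> b"
    by (simp add: invariant_pairing_def)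
  have b_zero: "y = 0" if "y \<in> U" "\<forall>x\<in>W. b x y = 0" for y
  proof -
    have "T y = 0"
      using that T_in[of y] by (auto simp: b_def dual_space_def fun_eq_iff)
    also have "0 = T 0"
      using P.linear_on_zero[OF T that(1)] by simp
    finally show ?thesis
      using bij that(1) \<tau>.subspace_0[OF \<tau>.subspace_V] by (auto simp: bij_betw_def inj_on_eq_iff)
  qed
  obtain y where y: "y \<in> U" "y \<noteq> 0"
    using \<tau>.nonzero \<tau>.subspace_0[OF \<tau>.subspace_V] by auto
  then obtain x where x: "x \<in> W" "b x y \<noteq> 0"
    using b_zero by blast
  have "\<exists>c. \<forall>x\<in>W. \<forall>y\<in>U. a x y = c * b x y" if a: "invariant_pairing G t W \<sigma> u U \<tau> a" for a
  proof -
    have bil: "bilinear_on t W u U a"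
      using a by (simp add: invariant_pairing_def)
    have a_in: "functional_of W a z \<in> dual_space t W" if "z \<in> U" for z
      by (rule functional_of_in_dual_space[OF \<sigma>.vector_space_axioms \<sigma>.subspace_V bil that])
    \<comment> \<open>\<open>A\<close> is chosen such that \<open>a x z = b x (A z)\<close> for
      \<open>x\<close> in \<open>W\<close> and \<open>z\<close> in \<open>U\<close>.\<close>
    define A where "A z = inv_into U T (functional_of W a z)" for z
    have A: "A z \<in> U" "T (A z) = functional_of W a z" if "z \<in> U" for z
      using bij a_in[OF that] by (auto simp: A_def bij_betw_def inv_into_into f_inv_into_f)
    have "linear_on (fun_scale (*)) u (dual_space t W) (inv_into U T)"
      by (rule P.linear_on_inv_into[OF T \<tau>.subspace_V bij])
    then have lin: "linear_on u u U A"
      using linear_on_functional_of[OF bil] a_in by (simp add: linear_on_def A_def)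
    obtain B where B: "finite B" "\<tau>.span B = U"
      using \<tau>.finite_dim by blast
    obtain c z where z: "z \<in> U" "z \<noteq> 0" "A z = u c z"
      by (rule eigenvector_exists[OF \<tau>.vector_space_axioms lin \<tau>.subspace_V A(1) B \<tau>.nonzero])
    \<comment> \<open>The eigenvector \<open>z\<close> lies in the right kernel of the invariant
      pairing \<open>a - c b\<close>, which therefore vanishes by irreducibility of
      \<open>U\<close>.\<close>
    have "a x z - c * b x z = 0" if "x \<in> W" for x
    proof -
      have "a x z = T (A z) x"
        using A(2) z(1) that by (simp add: functional_of_def)
      also have "\<dots> = c * b x z"
        using z by (simp add: linear_on_scale[OF T] fun_scale_def b_def)
      finally show ?thesis by simp
    qed
    then have "a x y - c * b x y = 0" if "x \<in> W" "y \<in> U" for x y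
      using degenerate_invariant_pairing[OF \<sigma>.group_representation_axioms \<tau>
          invariant_pairing_diff_scale[OF a b] z(1,2)] that by blast
    then show ?thesis by auto
  qed
  then show ?thesis
    using that b x y by blast
qed

section \<open>Invariant forms on a direct sum of irreducibles\<close>

lemma bilinear_on_sum:
  assumes "vector_space t" "vector_space u" and b: "bilinear_on t W u U b"
    and W: "module.subspace t W" and U: "module.subspace u U"
    and x: "\<And>i. i \<in> I \<Longrightarrow> x i \<in> W" and y: "\<And>j. j \<in> J \<Longrightarrow> y j \<in> U"
  shows "b (\<Sum>i\<in>I. x i) (\<Sum>j\<in>J. y j) = (\<Sum>(i, j)\<in>I \<times> J. b (x i) (y j))"
proof -
  interpret t: vector_space t by fact
  interpret u: vector_space u by fact
  interpret P: vector_space_pair t "(*) :: 'a \<Rightarrow> 'a \<Rightarrow> 'a"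
    by (simp add: vector_space_pair_def t.vector_space_axioms vector_space_field)
  interpret Q: vector_space_pair u "(*) :: 'a \<Rightarrow> 'a \<Rightarrow> 'a"
    by (simp add: vector_space_pair_def u.vector_space_axioms vector_space_field)
  have lin: "linear_on t (*) W (\<lambda>x. b x (\<Sum>j\<in>J. y j))" "\<And>i. i \<in> I \<Longrightarrow> linear_on u (*) U (b (x i))"
    using b x u.subspace_sum[OF U, of J y] y by (auto simp: bilinear_on_def)
  have "b (\<Sum>i\<in>I. x i) (\<Sum>j\<in>J. y j) = (\<Sum>i\<in>I. b (x i) (\<Sum>j\<in>J. y j))"
    by (rule P.linear_on_sum[OF lin(1) W x])
  also have "\<dots> = (\<Sum>i\<in>I. \<Sum>j\<in>J. b (x i) (y j))"
    using Q.linear_on_sum[OF lin(2) U y] by (intro sum.cong) auto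
  finally show ?thesis
    by (simp add: sum.cartesian_product)
qed

text \<open>The maps \<open>emb\<close> and \<open>proj\<close> present \<open>V\<close> as a direct
  sum. Each dual pair of summands has a generating pairing, unique up to a scalar, and the pullbacks
  of these generators along the projections form a basis of the invariant forms.\<close>

lemma dim_invariant_forms_decomposition:
  fixes s :: "'f::alg_closed_field \<Rightarrow> 'v::ab_group_add \<Rightarrow> 'v"
    and t :: "'f \<Rightarrow> 'w::ab_group_add \<Rightarrow> 'w"
    and W :: "'i \<Rightarrow> 'w set"
  assumes \<rho>: "group_representation G s V \<rho>" and fin: "finite I"
    and irr: "\<And>p. p \<in> I \<Longrightarrow> irreducible_representation G t (W p) (\<sigma> p)"
    and emb_lin: "\<And>p. p \<in> I \<Longrightarrow> linear_on t s (W p) (emb p)"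
    and emb_in: "\<And>p w. p \<in> I \<Longrightarrow> w \<in> W p \<Longrightarrow> emb p w \<in> V"
    and emb_equi: "\<And>p g w. p \<in> I \<Longrightarrow> g \<in> carrier G \<Longrightarrow> w \<in> W p \<Longrightarrow> emb p (\<sigma> p g w) = \<rho> g (emb p w)"
    and proj_lin: "\<And>p. p \<in> I \<Longrightarrow> linear_on s t V (proj p)"
    and proj_in: "\<And>p x. p \<in> I \<Longrightarrow> x \<in> V \<Longrightarrow> proj p x \<in> W p"
    and proj_equi: "\<And>p g x. p \<in> I \<Longrightarrow> g \<in> carrier G \<Longrightarrow> x \<in> V \<Longrightarrow> proj p (\<rho> g x) = \<sigma> p g (proj p x)"
    and proj_emb: "\<And>p q w. p \<in> I \<Longrightarrow> q \<in> I \<Longrightarrow> w \<in> W q \<Longrightarrow> proj p (emb q w) = (if p = q then w else 0)"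
    and decomp: "\<And>x. x \<in> V \<Longrightarrow> (\<Sum>p\<in>I. emb p (proj p x)) = x"
  shows "vector_space.dim form_scale (invariant_forms G s V \<rho>) =
    card {(p, q) \<in> I \<times> I.
      isomorphic_rep G t (W q) (\<sigma> q) (fun_scale (*)) (dual_space t (W p)) (dual_action G t (W p) (\<sigma> p))}"
    (is "_ = card ?P")
proof -
  interpret \<rho>: group_representation G s V \<rho> by fact
  interpret F: vector_space "form_scale :: 'f \<Rightarrow> ('v \<Rightarrow> 'v \<Rightarrow> 'f) \<Rightarrow> _"
    by (rule vector_space_form_scale)
  define P where "P = ?P"
  let ?pairing = "\<lambda>p q. invariant_pairing G t (W p) (\<sigma> p) t (W q) (\<sigma> q)"
  \<comment> \<open>Bundling the pairing, two vectors on which it is nonzero and its uniqueness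
    allows all of them to be chosen at once as functions of the pair \<open>z\<close>.\<close>
  define generator where "generator z b w w' \<longleftrightarrow> ?pairing (fst z) (snd z) b \<and>
      w \<in> W (fst z) \<and> w' \<in> W (snd z) \<and> b w w' \<noteq> 0 \<and>
      (\<forall>a. ?pairing (fst z) (snd z) a \<longrightarrow> (\<exists>c. \<forall>x\<in>W (fst z). \<forall>y\<in>W (snd z). a x y = c * b x y))"
    for z b w w'
  have "\<exists>b w w'. generator z b w w'" if "z \<in> P" for z
  proof -
    obtain p q where z: "z = (p, q)" "p \<in> I" "q \<in> I"
      and iso: "isomorphic_rep G t (W q) (\<sigma> q) (fun_scale (*)) (dual_space t (W p)) (dual_action G t (W p) (\<sigma> p))"
      using \<open>z \<in> P\<close> unfolding P_def by blast
    obtain b w w' where "?pairing p q b" "w \<in> W p" "w' \<in> W q" "b w w' \<noteq> 0"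
      "\<And>a. ?pairing p q a \<Longrightarrow> \<exists>c. \<forall>x\<in>W p. \<forall>y\<in>W q. a x y = c * b x y"
      using invariant_pairing_of_isomorphic_dual[OF irr[OF z(2)] irr[OF z(3)] iso] by blast
    then have "generator z b w w'"
      by (simp add: generator_def z(1))
    then show ?thesis by blast
  qed
  then obtain b w w' where gen: "\<And>z. z \<in> P \<Longrightarrow> generator z (b z) (w z) (w' z)"
    by metis
  have b: "?pairing (fst z) (snd z) (b z)" and w: "w z \<in> W (fst z)" and w': "w' z \<in> W (snd z)"
    and nz: "b z (w z) (w' z) \<noteq> 0" if "z \<in> P" for z
    using gen[OF that] by (simp_all add: generator_def)
  have uniq: "\<exists>c. \<forall>x\<in>W (fst z). \<forall>y\<in>W (snd z). a x y = c * b z x y"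
    if "z \<in> P" "?pairing (fst z) (snd z) a" for z a
    using gen[OF that(1)] that(2) unfolding generator_def by blast
  \<comment> \<open>The pullback of \<open>b z\<close> to \<open>V\<close>, set to zero outside
    \<open>V\<close> as \<open>bilinear_forms\<close> demands.\<close>
  define E where "E z = (\<lambda>x y. if x \<in> V \<and> y \<in> V then b z (proj (fst z) x) (proj (snd z) y) else 0)" for z
  have finP: "finite P"
    using fin by (auto simp: P_def intro: finite_subset[of _ "I \<times> I"])
  have PI: "fst z \<in> I" "snd z \<in> I" if "z \<in> P" for z
    using that by (auto simp: P_def)
  have bil: "bilinear_on t (W (fst z)) t (W (snd z)) (b z)" if "z \<in> P" for z
    using b[OF that] by (simp add: invariant_pairing_def)
  have b_zero: "x \<in> W (fst z) \<Longrightarrow> b z x 0 = 0" "y \<in> W (snd z) \<Longrightarrow> b z 0 y = 0" "b z 0 0 = 0"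
    if z: "z \<in> P" for z x y
  proof -
    interpret X: irreducible_representation G t "W (fst z)" "\<sigma> (fst z)"
      by (rule irr[OF PI(1)[OF z]])
    interpret Y: irreducible_representation G t "W (snd z)" "\<sigma> (snd z)"
      by (rule irr[OF PI(2)[OF z]])
    note zero = bilinear_on_zero[OF X.vector_space_axioms X.vector_space_axioms bil[OF z]]
    show "x \<in> W (fst z) \<Longrightarrow> b z x 0 = 0" "y \<in> W (snd z) \<Longrightarrow> b z 0 y = 0"
      using zero(1)[OF _ Y.subspace_V] zero(2)[OF _ X.subspace_V] by blast+
    show "b z 0 0 = 0"
      using zero(1)[OF _ Y.subspace_V] X.subspace_0[OF X.subspace_V] by blast
  qed
  \<comment> \<open>The test vectors of \<open>z'\<close> lie in single summands, so any other
    \<open>E z\<close> has an argument projected to zero. This diagonal matrix with nonzero diagonal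
    yields both injectivity of \<open>E\<close> and independence of its values.\<close>
  have E_eval: "E z (emb (fst z') (w z')) (emb (snd z') (w' z')) =
      (if z = z' then b z (w z) (w' z) else 0)" if z: "z \<in> P" and z': "z' \<in> P" for z z'
  proof -
    have "proj (fst z) (emb (fst z') (w z')) = (if fst z = fst z' then w z' else 0)"
      "proj (snd z) (emb (snd z') (w' z')) = (if snd z = snd z' then w' z' else 0)"
      using proj_emb[OF PI(1)[OF z] PI(1)[OF z'] w[OF z']]
        proj_emb[OF PI(2)[OF z] PI(2)[OF z'] w'[OF z']] by simp_all
    moreover have "emb (fst z') (w z') \<in> V" "emb (snd z') (w' z') \<in> V"
      using emb_in[OF PI(1)[OF z'] w[OF z']] emb_in[OF PI(2)[OF z'] w'[OF z']] by simp_all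
    moreover have "b z (w z') 0 = 0" if "fst z = fst z'"
      using b_zero(1)[OF z, of "w z'"] w[OF z'] that by simp
    moreover have "b z 0 (w' z') = 0" if "snd z = snd z'"
      using b_zero(2)[OF z, of "w' z'"] w'[OF z'] that by simp
    moreover have "b z 0 0 = 0"
      by (rule b_zero(3)[OF z])
    ultimately show ?thesis
      by (cases "fst z = fst z'"; cases "snd z = snd z'") (auto simp: E_def dest: prod_eqI)
  qed
  have inj: "inj_on E P"
  proof (rule inj_onI)
    fix z z' assume z: "z \<in> P" and z': "z' \<in> P" and eq: "E z = E z'"
    have "E z (emb (fst z') (w z')) (emb (snd z') (w' z')) \<noteq> 0"
      unfolding eq E_eval[OF z' z'] using nz[OF z'] by simp
    then show "z = z'"
      unfolding E_eval[OF z z'] by presburger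
  qed
  have ind: "F.independent (E ` P)"
  proof (rule F.independent_if_scalars_zero)
    fix c f assume sum0: "(\<Sum>f\<in>E ` P. form_scale (c f) f) = 0" and "f \<in> E ` P"
    then obtain z' where z': "z' \<in> P" "f = E z'" by blast
    let ?x = "emb (fst z') (w z')" and ?y = "emb (snd z') (w' z')"
    have "0 = (\<Sum>z\<in>P. form_scale (c (E z)) (E z)) ?x ?y"
      using sum0 by (simp add: sum.reindex[OF inj])
    also have "\<dots> = (\<Sum>z\<in>P. c (E z) * E z ?x ?y)"
      by (simp add: sum_fun_apply fun_scale_def)
    also have "\<dots> = (\<Sum>z\<in>P. if z = z' then c (E z') * b z' (w z') (w' z') else 0)"
      using E_eval z'(1) by (intro sum.cong) auto
    also have "\<dots> = c (E z') * b z' (w z') (w' z')"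
      using finP z'(1) by (simp add: sum.delta)
    finally show "c f = 0"
      using nz[OF z'(1)] z'(2) by simp
  qed (use finP in simp)
  have E_inv: "E z \<in> invariant_forms G s V \<rho>" if z: "z \<in> P" for z
  proof -
    have "invariant_pairing G s V \<rho> s V \<rho> (\<lambda>x y. b z (proj (fst z) x) (proj (snd z) y))"
      using PI[OF z] proj_in
      by (intro invariant_pairing_compose[OF b[OF z]] proj_lin proj_equi) auto
    then show ?thesis
      using \<rho>.rep_closed \<rho>.subspace_add[OF \<rho>.subspace_V] \<rho>.subspace_scale[OF \<rho>.subspace_V]
      by (simp add: invariant_forms_def bilinear_forms_def E_def invariant_pairing_def
          bilinear_on_def linear_on_def)
  qed
  have "\<beta> \<in> F.span (E ` P)" if \<beta>: "\<beta> \<in> invariant_forms G s V \<rho>" for \<beta>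
  proof -
    have \<beta>_pair: "invariant_pairing G s V \<rho> s V \<rho> \<beta>" and \<beta>_out: "\<And>x y. x \<notin> V \<or> y \<notin> V \<Longrightarrow> \<beta> x y = 0"
      using \<beta> by (auto simp: invariant_forms_def bilinear_forms_def invariant_pairing_def bilinear_on_def)
    \<comment> \<open>These are the blocks of \<open>\<beta>\<close>. A block in \<open>P\<close> is
      a multiple of its generator by uniqueness.\<close>
    have comp: "?pairing p q (\<lambda>x y. \<beta> (emb p x) (emb q y))" if "p \<in> I" "q \<in> I" for p q
      using that emb_in by (intro invariant_pairing_compose[OF \<beta>_pair] emb_lin emb_equi) auto
    have "\<exists>c. \<forall>x\<in>W (fst z). \<forall>y\<in>W (snd z). \<beta> (emb (fst z) x) (emb (snd z) y) = c * b z x y"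
      if "z \<in> P" for z
      using uniq[OF that comp] PI[OF that] by blast
    then obtain c where c: "\<And>z x y. z \<in> P \<Longrightarrow> x \<in> W (fst z) \<Longrightarrow> y \<in> W (snd z) \<Longrightarrow>
        \<beta> (emb (fst z) x) (emb (snd z) y) = c z * b z x y"
      by metis
    \<comment> \<open>A nonzero block would identify the second summand with the dual of the first
      and so place the pair in \<open>P\<close>.\<close>
    have out: "\<beta> (emb (fst z) x) (emb (snd z) y) = 0"
      if "z \<in> I \<times> I - P" "x \<in> W (fst z)" "y \<in> W (snd z)" for z x y
    proof (rule ccontr)
      assume "\<beta> (emb (fst z) x) (emb (snd z) y) \<noteq> 0"
      then have "z \<in> P"
        using isomorphic_dual_of_invariant_pairing[OF irr irr comp, of "fst z" "snd z"] that
        by (auto simp: P_def)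
      then show False using that by blast
    qed
    have "\<beta> x y = (\<Sum>z\<in>P. c z * E z x y)" for x y
    proof (cases "x \<in> V \<and> y \<in> V")
      case True
      have "\<beta> x y = \<beta> (\<Sum>p\<in>I. emb p (proj p x)) (\<Sum>p\<in>I. emb p (proj p y))"
        using True by (simp add: decomp)
      also have "\<dots> = (\<Sum>z\<in>I \<times> I. \<beta> (emb (fst z) (proj (fst z) x)) (emb (snd z) (proj (snd z) y)))"
        using bilinear_on_sum[OF \<rho>.vector_space_axioms \<rho>.vector_space_axioms _ \<rho>.subspace_V \<rho>.subspace_V,
            of \<beta> I "\<lambda>p. emb p (proj p x)" I "\<lambda>p. emb p (proj p y)"]
          \<beta>_pair emb_in proj_in True
        by (simp add: invariant_pairing_def case_prod_unfold)
      also have "\<dots> = (\<Sum>z\<in>P. \<beta> (emb (fst z) (proj (fst z) x)) (emb (snd z) (proj (snd z) y)))"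
        using fin True proj_in out PI by (intro sum.mono_neutral_right) auto
      also have "\<dots> = (\<Sum>z\<in>P. c z * E z x y)"
        using True proj_in PI c by (intro sum.cong) (simp_all add: E_def)
      finally show ?thesis .
    qed (use \<beta>_out in \<open>auto simp: E_def\<close>)
    then have "\<beta> = (\<Sum>z\<in>P. form_scale (c z) (E z))"
      unfolding fun_eq_iff sum_fun_apply fun_scale_def by blast
    also have "\<dots> \<in> F.span (E ` P)"
      by (intro F.span_sum F.span_scale F.span_base) auto
    finally show ?thesis .
  qed
  moreover have "F.span (E ` P) \<subseteq> invariant_forms G s V \<rho>"
    using E_inv by (intro F.span_minimal subspace_invariant_forms) auto
  ultimately have "F.span (E ` P) = invariant_forms G s V \<rho>"
    by blast
  then have "F.span (E ` P) = F.span (invariant_forms G s V \<rho>)"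
    by (metis F.span_span)
  then have "F.dim (invariant_forms G s V \<rho>) = card (E ` P)"
    using ind by (rule F.dim_eq_card)
  then show ?thesis
    unfolding card_image[OF inj] by (simp only: P_def)
qed

section \<open>Multiplicities and the dimension formula\<close>

lemma finite_copies: "finite (copies r k)"
  by (simp add: copies_def)

text \<open>Regrouping \<open>((i, c), (j, d))\<close> as \<open>((i, j), (c, d))\<close> leaves
  \<open>k i * k j\<close> choices of copies over each index pair in \<open>D\<close>.\<close>

lemma card_pairs_of_copies:
  assumes "D \<subseteq> {1..r} \<times> {1..r}"
  shows "card {(p, q) \<in> copies r k \<times> copies r k. (fst p, fst q) \<in> D} = (\<Sum>(i, j)\<in>D. k i * k j)"
proof -
  let ?S = "SIGMA (i, j):D. {..<k i} \<times> {..<k j}"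
  have "bij_betw (\<lambda>((i, c), (j, d)). ((i, j), (c, d)))
      {(p, q) \<in> copies r k \<times> copies r k. (fst p, fst q) \<in> D} ?S"
    by (rule bij_betw_byWitness[where f' = "\<lambda>((i, j), (c, d)). ((i, c), (j, d))"])
      (use assms in \<open>auto simp: copies_def\<close>)
  then have "card {(p, q) \<in> copies r k \<times> copies r k. (fst p, fst q) \<in> D} = card ?S"
    by (rule bij_betw_same_card)
  also have "\<dots> = (\<Sum>(i, j)\<in>D. k i * k j)"
    using finite_subset[OF assms] by (subst card_SigmaI) (auto intro!: sum.cong)
  finally show ?thesis .
qed

text \<open>The isomorphism \<open>T\<close> onto the external sum supplies the decomposition: the
  projections are the coordinates of \<open>T\<close>, and the embeddings are its inverse after
  placing a vector in one coordinate.\<close>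

theorem dim_invariant_forms_direct_sum:
  fixes s :: "'f::alg_closed_field \<Rightarrow> 'v::ab_group_add \<Rightarrow> 'v"
    and t :: "'f \<Rightarrow> 'w::ab_group_add \<Rightarrow> 'w"
  assumes \<rho>: "group_representation G s V \<rho>" and t: "vector_space t"
    and irr: "\<And>i. i \<in> {1..r} \<Longrightarrow> irreducible_representation G t (W i) (\<sigma> i)"
    and iso: "isomorphic_rep G s V \<rho> (fun_scale t) (sum_space r k W) (sum_action r k W \<sigma>)"
  shows "vector_space.dim form_scale (invariant_forms G s V \<rho>) =
    (\<Sum>(i, j)\<in>dual_pairs G t r W \<sigma>. k i * k j)"
proof -
  interpret \<rho>: group_representation G s V \<rho> by fact
  interpret t: vector_space t by fact
  interpret T: vector_space_pair s "fun_scale t :: 'f \<Rightarrow> (nat \<times> nat \<Rightarrow> 'w) \<Rightarrow> _"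
    by (simp add: vector_space_pair_def \<rho>.vector_space_axioms vector_space_fun_scale t)
  interpret T': vector_space_pair "fun_scale t :: 'f \<Rightarrow> (nat \<times> nat \<Rightarrow> 'w) \<Rightarrow> _" s
    by (simp add: vector_space_pair_def \<rho>.vector_space_axioms vector_space_fun_scale t)
  let ?I = "copies r k" and ?S = "sum_space r k W"
  obtain T where bij: "bij_betw T V ?S" and T: "linear_on s (fun_scale t) V T"
    and equi: "\<And>g x. g \<in> carrier G \<Longrightarrow> x \<in> V \<Longrightarrow> T (\<rho> g x) = sum_action r k W \<sigma> g (T x)"
    using iso unfolding isomorphic_rep_def by blast
  have irr': "irreducible_representation G t (W (fst p)) (\<sigma> (fst p))" if "p \<in> ?I" for p
    using that irr by (auto simp: copies_def)
  have repW: "group_representation G t (W (fst p)) (\<sigma> (fst p))" if "p \<in> ?I" for p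
    using irr'[OF that] by (rule irreducible_representation.axioms)
  have W: "t.subspace (W (fst p))" if "p \<in> ?I" for p
    using repW[OF that] by (rule group_representation.subspace_V)
  define \<iota> where "\<iota> p w = (\<lambda>q. if q = p then w else 0)" for p :: "nat \<times> nat" and w :: 'w
  have \<iota>_in: "\<iota> p w \<in> ?S" if "p \<in> ?I" "w \<in> W (fst p)" for p w
    using that t.subspace_0[OF W] by (auto simp: \<iota>_def sum_space_def)
  have T_in: "T x \<in> ?S" if "x \<in> V" for x
    using bij that by (auto simp: bij_betw_def)
  define Ti where "Ti = inv_into V T"
  have Ti: "Ti f \<in> V" "T (Ti f) = f" if "f \<in> ?S" for f
    using bij that by (auto simp: Ti_def bij_betw_def inv_into_into f_inv_into_f)
  have TiT: "Ti (T x) = x" if "x \<in> V" for x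
    using bij that by (auto simp: Ti_def bij_betw_def)
  have Ti_lin: "linear_on (fun_scale t) s ?S Ti"
    unfolding Ti_def by (rule T.linear_on_inv_into[OF T \<rho>.subspace_V bij])
  have S: "T.vs2.subspace ?S"
    using T.subspace_linear_on_image[OF T \<rho>.subspace_V] bij by (simp add: bij_betw_def)
  have action_\<iota>: "sum_action r k W \<sigma> g (\<iota> p w) = \<iota> p (\<sigma> (fst p) g w)"
    if p: "p \<in> ?I" and g: "g \<in> carrier G" and w: "w \<in> W (fst p)" for p g w
  proof -
    \<comment> \<open>The action is applied in every coordinate, so the padding zeros have to be
      preserved.\<close>
    have "\<sigma> (fst q) g 0 = 0" if "q \<in> ?I" for q
    proof -
      interpret q: group_representation G t "W (fst q)" "\<sigma> (fst q)"
        by (rule repW[OF that])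
      interpret vector_space_pair t t
        by (simp add: vector_space_pair_def t)
      show ?thesis
        using linear_on_zero[OF q.linear_on_rep[OF g] t.subspace_0[OF q.subspace_V]] .
    qed
    then show ?thesis
      using \<iota>_in[OF p w] p by (auto simp: sum_action_def \<iota>_def fun_eq_iff)
  qed
  have "vector_space.dim form_scale (invariant_forms G s V \<rho>) =
    card {(p, q) \<in> ?I \<times> ?I. isomorphic_rep G t (W (fst q)) (\<sigma> (fst q)) (fun_scale (*))
      (dual_space t (W (fst p))) (dual_action G t (W (fst p)) (\<sigma> (fst p)))}"
  proof (rule dim_invariant_forms_decomposition[where emb = "\<lambda>p w. Ti (\<iota> p w)" and proj = "\<lambda>p x. T x p",
        OF \<rho> finite_copies irr'])
    fix p assume p: "p \<in> ?I"
    have "\<iota> p (x + y) = \<iota> p x + \<iota> p y" "\<iota> p (t c x) = fun_scale t c (\<iota> p x)" for x y c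
      by (auto simp: \<iota>_def fun_scale_def)
    then show "linear_on t s (W (fst p)) (\<lambda>w. Ti (\<iota> p w))"
      using Ti_lin \<iota>_in[OF p] by (simp add: linear_on_def)
    show "linear_on s t V (\<lambda>x. T x p)"
      using T by (simp add: linear_on_def fun_scale_def)
    show Ti_in: "Ti (\<iota> p w) \<in> V" if "w \<in> W (fst p)" for w
      using Ti \<iota>_in[OF p that] by blast
    show "T x p \<in> W (fst p)" if "x \<in> V" for x
      using T_in[OF that] p by (simp add: sum_space_def)
    show "T (\<rho> g x) p = \<sigma> (fst p) g (T x p)" if "g \<in> carrier G" "x \<in> V" for g x
      using that T_in p by (simp add: equi sum_action_def)
    show "Ti (\<iota> p (\<sigma> (fst p) g w)) = \<rho> g (Ti (\<iota> p w))" if g: "g \<in> carrier G" and w: "w \<in> W (fst p)" for g w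
    proof -
      have "T (\<rho> g (Ti (\<iota> p w))) = \<iota> p (\<sigma> (fst p) g w)"
        using equi[OF g Ti_in[OF w]] Ti(2)[OF \<iota>_in[OF p w]] action_\<iota>[OF p g w] by simp
      then show ?thesis
        using TiT[OF \<rho>.rep_closed[OF g Ti_in[OF w]]] by simp
    qed
    show "T (Ti (\<iota> q w)) p = (if p = q then w else 0)" if "q \<in> ?I" "w \<in> W (fst q)" for q w
      using Ti(2)[OF \<iota>_in[OF that]] by (simp add: \<iota>_def)
  next
    fix x assume x: "x \<in> V"
    have in_S: "\<iota> p (T x p) \<in> ?S" if "p \<in> ?I" for p
      using \<iota>_in[OF that] T_in[OF x] that by (simp add: sum_space_def)
    have "(\<Sum>p\<in>?I. \<iota> p (T x p)) = T x"
    proof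
      fix q
      have "(\<Sum>p\<in>?I. \<iota> p (T x p)) q = (\<Sum>p\<in>?I. if p = q then T x q else 0)"
        unfolding sum_fun_apply by (rule sum.cong) (auto simp: \<iota>_def)
      also have "\<dots> = T x q"
        using T_in[OF x] by (cases q) (auto simp: finite_copies sum_space_def)
      finally show "(\<Sum>p\<in>?I. \<iota> p (T x p)) q = T x q" .
    qed
    moreover have "Ti (\<Sum>p\<in>?I. \<iota> p (T x p)) = (\<Sum>p\<in>?I. Ti (\<iota> p (T x p)))"
      by (rule T'.linear_on_sum[OF Ti_lin S in_S])
    ultimately show "(\<Sum>p\<in>?I. Ti (\<iota> p (T x p))) = x"
      using TiT[OF x] by simp
  qed
  \<comment> \<open>Whether two copies are dual depends only on their irreducible indices, not on
    the copy numbers.\<close>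
  also have "\<dots> = card {(p, q) \<in> ?I \<times> ?I. (fst p, fst q) \<in> dual_pairs G t r W \<sigma>}"
    by (rule arg_cong[of _ _ card]) (auto simp: dual_pairs_def copies_def)
  also have "\<dots> = (\<Sum>(i, j)\<in>dual_pairs G t r W \<sigma>. k i * k j)"
    by (rule card_pairs_of_copies) (auto simp: dual_pairs_def)
  finally show ?thesis .
qed

theorem theorem4p1:
  fixes G :: "('g, 'm) monoid_scheme"
    and s :: "'f::alg_closed_field \<Rightarrow> 'v::ab_group_add \<Rightarrow> 'v"
    and t :: "'f \<Rightarrow> 'w::ab_group_add \<Rightarrow> 'w"
    and V :: "'v set" and \<rho> :: "'g \<Rightarrow> 'v \<Rightarrow> 'v"
    and W :: "nat \<Rightarrow> 'w set" and \<sigma> :: "nat \<Rightarrow> 'g \<Rightarrow> 'w \<Rightarrow> 'w"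
    and n r :: nat and k :: "nat \<Rightarrow> nat"
  assumes "group G" and "Coset.order G = 8"
    and "CHAR('f) \<noteq> 2"
    and "n > 0"
    and "complete_irreps G t r W \<sigma>"
    and "group_representation G s V \<rho>" and "vector_space.dim s V = n"
    and "isomorphic_rep G s V \<rho> (fun_scale t) (sum_space r k W) (sum_action r k W \<sigma>)"
  shows "vector_space.dim form_scale (invariant_forms G s V \<rho>) =
    (\<Sum>(i, j)\<in>dual_pairs G t r W \<sigma>. k i * k j)"
proof (rule dim_invariant_forms_direct_sum)
  show irr: "irreducible_representation G t (W i) (\<sigma> i)" if "i \<in> {1..r}" for i
    using assms(5) that by (simp add: complete_irreps_def)
  show "vector_space t" \<comment> \<open>known only through the \<open>W i\<close>; if there are none, then \<open>V = {0}\<close>, against \<open>n > 0\<close>\<close>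
  proof (cases "r = 0")
    case True
    interpret \<rho>: group_representation G s V \<rho> by (rule assms(6))
    have "sum_space r k W = {0}"
      using True by (auto simp: sum_space_def copies_def fun_eq_iff)
    then obtain T :: "'v \<Rightarrow> nat \<times> nat \<Rightarrow> 'w" where "inj_on T V" "T ` V = {0}"
      using assms(8) by (auto simp: isomorphic_rep_def bij_betw_def)
    then have "V \<subseteq> {0}"
      using \<rho>.subspace_0[OF \<rho>.subspace_V] by (auto simp: inj_on_def image_subset_iff dest!: equalityD1)
    then have "\<rho>.dim V = 0"
      using \<rho>.dim_le_card[of V "{}"] by simp
    then show ?thesis
      using assms(4,7) by simp
  next
    case False
    then have "irreducible_representation G t (W 1) (\<sigma> 1)"
      by (intro irr) simp
    then show ?thesis
      by (intro group_representation.axioms(2) irreducible_representation.axioms(1))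
  qed
qed (use assms in auto)

end
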